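(* There exist an integer $r \geq 1$ and a finite set $F\subseteq \overline{\mathbb{Q}}[\sigma^i(T_1),\ldots,\sigma^i(T_r)\mid i\in\mathbb{N}]$ of difference polynomials over $\overline{\mathbb{Q}}$ such that $$\mathcal{I}(\mathcal{V}(F))\supsetneqq \sqrt{\langle \sigma^i(F) \mid i\in\mathbb{N}\rangle},$$ where $\mathcal{V}(F)$ is the set of all solutions of $F=0$ in $(\overline{\mathbb{Q}}^{\mathbb{N}})^r$ and $\mathcal{I}(\mathcal{V}(F))$ is the set of all difference polynomials in $\overline{\mathbb{Q}}[\sigma^i(T_1),\ldots,\sigma^i(T_r)\mid i\in\mathbb{N}]$ that vanish on all elements of $\mathcal{V}(F)$.
   Context: $\mathbb{N}$ is the set of nonnegative integers and $\overline{\mathbb{Q}}$ is an algebraic closure of $\mathbb{Q}$. For a field $k$, the ring $k^{\mathbb{N}}$ of sequences has componentwise operations and the shift endomorphism $\sigma((x_i)_{i\in\mathbb{N}})=(x_{i+1})_{i\in\mathbb{N}}$; $k$ embeds as the constant sequences. The ring of difference polynomials $k[\sigma^i(T_1),\ldots,\sigma^i(T_r)\mid i\in\mathbb{N}]$ is the polynomial ring over $k$ in the indeterminates $\sigma^i(T_j)$, with endomorphism $\sigma$ that is the identity on $k$ and satisfies $\sigma(\sigma^i(T_j))=\sigma^{i+1}(T_j)$. A difference polynomial $f$ is evaluated at $\mathbf{x}\in(k^{\mathbb{N}})^r$ by the unique $k$-algebra morphism to $k^{\mathbb{N}}$ commuting with $\sigma$ and sending $T_j\mapsto x_j$; $\mathbf{x}$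 is a solution of $F=0$ if every $f\in F$ evaluates to $0$ (the zero sequence) at $\mathbf{x}$. $\langle\cdot\rangle$ denotes the generated ideal and $\sqrt{\cdot}$ the radical. *)

theory Defs
  imports
    "HOL-Algebra.Algebraic_Closure_Type"
    "HOL-Library.Poly_Mapping"
    "HOL-Library.Function_Algebras"
    "HOL-Library.FuncSet"
begin

section \<open>Evaluation of polynomials in arbitrarily many variables\<close>

text \<open>
  A polynomial over \<open>'k\<close> in variables of type \<open>'v\<close> maps monomials (exponent vectors of
  type \<open>'v \<Rightarrow>\<^sub>0 nat\<close>) to coefficients.  \<open>mpoly_eval h a\<close> applies \<open>h\<close> to the coefficients
  and substitutes \<open>a v\<close> for the variable \<open>v\<close>.
\<close>

definition mpoly_eval ::
    "('k::zero \<Rightarrow> 'b::comm_semiring_1) \<Rightarrow> ('v \<Rightarrow> 'b) \<Rightarrow> (('v \<Rightarrow>\<^sub>0 nat) \<Rightarrow>\<^sub>0 'k) \<Rightarrow> 'b" where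
  "mpoly_eval h a p =
     (\<Sum>m\<in>Poly_Mapping.keys p. h (Poly_Mapping.lookup p m) *
        (\<Prod>v\<in>Poly_Mapping.keys m. a v ^ Poly_Mapping.lookup m v))"


section \<open>Difference polynomials\<close>

text \<open>
  The variable \<open>(i, j)\<close> stands for \<open>\<sigma>\<^sup>i(T\<^sub>j)\<close>.  The type admits all \<open>j\<close>; the ring in
  \<open>T\<^sub>1, \<dots>, T\<^sub>r\<close> is cut out by \<open>diff_poly_ring r\<close> below.
\<close>

type_synonym 'k diff_poly = "((nat \<times> nat) \<Rightarrow>\<^sub>0 nat) \<Rightarrow>\<^sub>0 'k"

definition dconst :: "'k::comm_ring_1 \<Rightarrow> 'k diff_poly" where
  "dconst c = Poly_Mapping.single 0 c"

definition dvar :: "nat \<Rightarrow> nat \<Rightarrow> 'k::comm_ring_1 diff_poly" where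
  "dvar i j = Poly_Mapping.single (Poly_Mapping.single (i, j) 1) 1"

definition dshift :: "'k::comm_ring_1 diff_poly \<Rightarrow> 'k diff_poly" where
  "dshift = mpoly_eval dconst (\<lambda>(i, j). dvar (Suc i) j)"

definition diff_poly_ring :: "nat \<Rightarrow> 'k::comm_ring_1 diff_poly ring" where
  "diff_poly_ring r = ring_of_type_algebra
     \<lparr>carrier := {p. \<forall>m\<in>Poly_Mapping.keys p. Poly_Mapping.keys m \<subseteq> UNIV \<times> {1..r}}\<rparr>"


section \<open>Solutions in sequences\<close>

text \<open>
  The ring of sequences is the type \<open>nat \<Rightarrow> 'k\<close> with the pointwise operations
  of \<^theory>\<open>HOL-Library.Function_Algebras\<close>.  An \<open>r\<close>-tuple of sequences
  is a function in \<open>{1..r} \<rightarrow>\<^sub>E UNIV\<close>.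
\<close>

definition seq_shift :: "(nat \<Rightarrow> 'k) \<Rightarrow> nat \<Rightarrow> 'k" where
  "seq_shift x = (\<lambda>n. x (Suc n))"

definition diff_eval ::
    "(nat \<Rightarrow> nat \<Rightarrow> 'k) \<Rightarrow> 'k::comm_ring_1 diff_poly \<Rightarrow> nat \<Rightarrow> 'k" where
  "diff_eval x = mpoly_eval (\<lambda>c _. c) (\<lambda>(i, j). (seq_shift ^^ i) (x j))"

definition diff_solutions ::
    "nat \<Rightarrow> 'k::comm_ring_1 diff_poly set \<Rightarrow> (nat \<Rightarrow> nat \<Rightarrow> 'k) set" where
  "diff_solutions r F = {x \<in> {1..r} \<rightarrow>\<^sub>E UNIV. \<forall>f\<in>F. diff_eval x f = 0}"

definition diff_vanishing ::
    "nat \<Rightarrow> (nat \<Rightarrow> nat \<Rightarrow> 'k) set \<Rightarrow> 'k::comm_ring_1 diff_poly set" where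
  "diff_vanishing r V = {p \<in> carrier (diff_poly_ring r). \<forall>x\<in>V. diff_eval x p = 0}"

definition ideal_radical :: "('a, 'm) ring_scheme \<Rightarrow> 'a set \<Rightarrow> 'a set" where
  "ideal_radical R I = {a \<in> carrier R. \<exists>n::nat. n > 0 \<and> a [^]\<^bsub>R\<^esub> n \<in> I}"


section \<open>The definitions have the expected properties\<close>

lemma mpoly_eval_0 [simp]: "mpoly_eval h a 0 = 0"
  by (simp add: mpoly_eval_def)

lemma mpoly_eval_add:
  assumes "h 0 = 0" "\<And>c d. h (c + d) = h c + h d"
  shows "mpoly_eval h a (p + q) = mpoly_eval h a p + mpoly_eval h a q"
  unfolding mpoly_eval_def
  by (rule setsum_keys_plus_distrib) (simp_all add: assms distrib_right)

lemma mpoly_eval_sum: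
  assumes "h 0 = 0" "\<And>c d. h (c + d) = h c + h d"
  shows "mpoly_eval h a (sum f A) = (\<Sum>i\<in>A. mpoly_eval h a (f i))"
  by (induction A rule: infinite_finite_induct) (simp_all add: mpoly_eval_add[of h] assms)

lemma mpoly_eval_single:
  assumes "h 0 = 0"
  shows "mpoly_eval h a (Poly_Mapping.single m c) =
           h c * (\<Prod>v\<in>Poly_Mapping.keys m. a v ^ Poly_Mapping.lookup m v)"
  using assms by (cases "c = 0") (simp_all add: mpoly_eval_def)

lemma mpoly_eq_sum_single:
  fixes p :: "'m \<Rightarrow>\<^sub>0 'k::comm_monoid_add"
  shows "p = (\<Sum>m\<in>Poly_Mapping.keys p. Poly_Mapping.single m (Poly_Mapping.lookup p m))"
proof (rule poly_mapping_eqI)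
  fix m
  show "Poly_Mapping.lookup p m = Poly_Mapping.lookup
      (\<Sum>m\<in>Poly_Mapping.keys p. Poly_Mapping.single m (Poly_Mapping.lookup p m)) m"
    by (cases "m \<in> Poly_Mapping.keys p")
       (auto simp: lookup_sum lookup_single when_def in_keys_iff)
qed

lemma monomial_eval_add:
  fixes a :: "'v \<Rightarrow> 'b::comm_semiring_1" and m n :: "'v \<Rightarrow>\<^sub>0 nat"
  shows "(\<Prod>v\<in>Poly_Mapping.keys (m + n). a v ^ Poly_Mapping.lookup (m + n) v) =
    (\<Prod>v\<in>Poly_Mapping.keys m. a v ^ Poly_Mapping.lookup m v) *
    (\<Prod>v\<in>Poly_Mapping.keys n. a v ^ Poly_Mapping.lookup n v)"
proof -
  let ?A = "Poly_Mapping.keys m \<union> Poly_Mapping.keys n"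
  have *: "(\<Prod>v\<in>Poly_Mapping.keys k. a v ^ Poly_Mapping.lookup k v) =
      (\<Prod>v\<in>?A. a v ^ Poly_Mapping.lookup k v)" if "Poly_Mapping.keys k \<subseteq> ?A" for k
    using that by (intro prod.mono_neutral_left) (auto simp: in_keys_iff)
  show ?thesis
    by (subst (1 2 3) *) (auto simp: lookup_add power_add prod.distrib dest: subsetD[OF keys_add])
qed

lemma mpoly_eval_mult:
  fixes h :: "'k::comm_ring_1 \<Rightarrow> 'b::comm_ring_1"
  assumes "h 0 = 0" "\<And>c d. h (c + d) = h c + h d" "\<And>c d. h (c * d) = h c * h d"
  shows "mpoly_eval h a (p * q) = mpoly_eval h a p * mpoly_eval h a q"
proof -
  let ?s = "\<lambda>p m. Poly_Mapping.single m (Poly_Mapping.lookup p m)"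
  have "p * q = (\<Sum>m\<in>Poly_Mapping.keys p. ?s p m) * (\<Sum>n\<in>Poly_Mapping.keys q. ?s q n)"
    by (simp flip: mpoly_eq_sum_single)
  also have "\<dots> = (\<Sum>m\<in>Poly_Mapping.keys p. \<Sum>n\<in>Poly_Mapping.keys q.
      Poly_Mapping.single (m + n) (Poly_Mapping.lookup p m * Poly_Mapping.lookup q n))"
    by (simp add: sum_product mult_single)
  finally show ?thesis
    by (simp add: mpoly_eval_sum[of h] mpoly_eval_single assms monomial_eval_add)
       (simp add: mpoly_eval_def sum_product mult_ac)
qed

lemma mpoly_eval_power:
  fixes h :: "'k::comm_ring_1 \<Rightarrow> 'b::comm_ring_1"
  assumes "h 0 = 0" "h 1 = 1" "\<And>c d. h (c + d) = h c + h d" "\<And>c d. h (c * d) = h c * h d"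
  shows "mpoly_eval h a (p ^ n) = mpoly_eval h a p ^ n"
proof (induction n)
  case 0
  have "mpoly_eval h a 1 = 1"
    using assms mpoly_eval_single[of h a 0 1] by simp
  then show ?case by simp
qed (simp add: mpoly_eval_mult[of h] assms)

lemma dconst_hom [simp]:
  "dconst 0 = 0" "dconst 1 = 1" "dconst (c + d) = dconst c + dconst d"
  "dconst (c * d) = dconst c * dconst d"
  by (simp_all add: dconst_def single_add mult_single)

lemma diff_eval_hom [simp]:
  "diff_eval x 0 = 0" "diff_eval x 1 = 1"
  "diff_eval x (p + q) = diff_eval x p + diff_eval x q"
  "diff_eval x (p * q) = diff_eval x p * diff_eval x q"
  using mpoly_eval_power[of "\<lambda>c _. c" _ _ 0]
  by (simp_all add: diff_eval_def mpoly_eval_add mpoly_eval_mult fun_eq_iff)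

lemma dshift_hom [simp]:
  "dshift 0 = 0" "dshift 1 = 1"
  "dshift (p + q) = dshift p + dshift q"
  "dshift (p * q) = dshift p * dshift q"
  using mpoly_eval_power[of dconst _ _ 0]
  by (simp_all add: dshift_def mpoly_eval_add mpoly_eval_mult)

lemma dshift_dconst [simp]: "dshift (dconst c) = dconst c"
  by (simp add: dshift_def dconst_def[of c] mpoly_eval_single)

lemma dshift_dvar [simp]: "dshift (dvar i j) = dvar (Suc i) j"
  by (simp add: dshift_def dvar_def[of i j] mpoly_eval_single)

lemma diff_eval_dconst [simp]: "diff_eval x (dconst c) = (\<lambda>_. c)"
  by (simp add: diff_eval_def dconst_def mpoly_eval_single fun_eq_iff)

lemma diff_eval_dvar [simp]: "diff_eval x (dvar i j) = (seq_shift ^^ i) (x j)"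
  by (simp add: diff_eval_def dvar_def mpoly_eval_single fun_eq_iff)

lemma single_eq_prod_dvar:
  "Poly_Mapping.single m c =
     dconst c * (\<Prod>(i, j)\<in>Poly_Mapping.keys m. dvar i j ^ Poly_Mapping.lookup m (i, j))"
proof -
  have pow: "dvar i j ^ n =
      (Poly_Mapping.single (Poly_Mapping.single (i, j) n) 1 :: 'a diff_poly)" for i j n
    by (induction n) (simp_all add: dvar_def mult_single flip: single_add)
  have "(\<Prod>v\<in>A. Poly_Mapping.single (f v) (1::'a)) = Poly_Mapping.single (sum f A) 1"
    for A :: "(nat \<times> nat) set" and f :: "_ \<Rightarrow> (nat \<times> nat) \<Rightarrow>\<^sub>0 nat"
    by (induction A rule: infinite_finite_induct) (simp_all add: mult_single)
  then show ?thesis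
    by (simp add: dconst_def pow case_prod_unfold mult_single flip: mpoly_eq_sum_single)
qed

lemma diff_poly_ring_simps [simp]:
  "monoid.mult (diff_poly_ring r) = (*)" "add (diff_poly_ring r) = (+)"
  "ring.zero (diff_poly_ring r) = 0" "monoid.one (diff_poly_ring r) = 1"
  by (simp_all add: diff_poly_ring_def ring_of_type_algebra_def)

lemma diff_poly_ring_pow: "p [^]\<^bsub>diff_poly_ring r\<^esub> (n::nat) = p ^ n"
  by (induction n) (simp_all add: nat_pow_def mult.commute)

lemma diff_poly_ring_closed:
  "0 \<in> carrier (diff_poly_ring r)" "1 \<in> carrier (diff_poly_ring r)"
  "dconst c \<in> carrier (diff_poly_ring r)"
  "j \<in> {1..r} \<Longrightarrow> dvar i j \<in> carrier (diff_poly_ring r)"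
  "p \<in> carrier (diff_poly_ring r) \<Longrightarrow> - p \<in> carrier (diff_poly_ring r)"
  "p \<in> carrier (diff_poly_ring r) \<Longrightarrow> q \<in> carrier (diff_poly_ring r) \<Longrightarrow>
     p + q \<in> carrier (diff_poly_ring r)"
  by (auto simp: diff_poly_ring_def dconst_def dvar_def in_keys_iff lookup_single when_def
                 lookup_one lookup_uminus split: if_splits dest!: subsetD[OF keys_add])

lemma diff_poly_ring_closed_mult:
  assumes "p \<in> carrier (diff_poly_ring r)" "q \<in> carrier (diff_poly_ring r)"
  shows "p * q \<in> carrier (diff_poly_ring r)"
proof -
  have "Poly_Mapping.keys m \<subseteq> UNIV \<times> {1..r}" if m: "m \<in> Poly_Mapping.keys (p * q)" for m
  proof -
    obtain a b where ab: "m = a + b" "a \<in> Poly_Mapping.keys p" "b \<in> Poly_Mapping.keys q"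
      using m keys_mult[of p q] by blast
    then have "Poly_Mapping.keys a \<subseteq> UNIV \<times> {1..r}" "Poly_Mapping.keys b \<subseteq> UNIV \<times> {1..r}"
      using assms by (simp_all add: diff_poly_ring_def)
    then show ?thesis
      using keys_add[of a b] ab(1) by blast
  qed
  then show ?thesis
    by (simp add: diff_poly_ring_def)
qed

lemma diff_poly_ring_cring: "cring (diff_poly_ring r)"
proof -
  have "\<exists>q\<in>carrier (diff_poly_ring r). q + p = 0" if "p \<in> carrier (diff_poly_ring r)" for p
    using that diff_poly_ring_closed(5) by (intro bexI[of _ "- p"]) auto
  moreover have "\<exists>q\<in>carrier (diff_poly_ring r). p + q = 0" if "p \<in> carrier (diff_poly_ring r)" for p
    using that diff_poly_ring_closed(5) by (intro bexI[of _ "- p"]) auto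
  ultimately show ?thesis
    by unfold_locales
       (auto simp: diff_poly_ring_closed diff_poly_ring_closed_mult algebra_simps Units_def)
qed

lemma diff_poly_induct [consumes 1, case_names const var add mult]:
  assumes p: "p \<in> carrier (diff_poly_ring r)"
    and const: "\<And>c. P (dconst c)"
    and var: "\<And>i j. j \<in> {1..r} \<Longrightarrow> P (dvar i j)"
    and add: "\<And>p q. p \<in> carrier (diff_poly_ring r) \<Longrightarrow> q \<in> carrier (diff_poly_ring r) \<Longrightarrow>
                P p \<Longrightarrow> P q \<Longrightarrow> P (p + q)"
    and mult: "\<And>p q. p \<in> carrier (diff_poly_ring r) \<Longrightarrow> q \<in> carrier (diff_poly_ring r) \<Longrightarrow>
                P p \<Longrightarrow> P q \<Longrightarrow> P (p * q)"
  shows "P p"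
proof -
  let ?Q = "\<lambda>p. p \<in> carrier (diff_poly_ring r) \<and> P p"
  have Q0: "?Q 0" and Q1: "?Q 1"
    using const[of 0] const[of 1] diff_poly_ring_closed(1,2)[of r] by simp_all
  have Qadd: "?Q (p + q)" if "?Q p" "?Q q" for p q
    using that add diff_poly_ring_closed(6) by blast
  have Qmult: "?Q (p * q)" if "?Q p" "?Q q" for p q
    using that mult diff_poly_ring_closed_mult by blast
  have Qpow: "?Q (p ^ n)" if "?Q p" for p n
    by (induction n) (use that Q1 Qmult in \<open>simp_all only: power.simps\<close>)
  have Qsum: "?Q (sum f A)" if "\<And>i. i \<in> A \<Longrightarrow> ?Q (f i)" for f and A :: "((nat \<times> nat) \<Rightarrow>\<^sub>0 nat) set"
    using that
    by (induction A rule: infinite_finite_induct) (use Q0 Qadd in \<open>simp_all\<close>)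
  have Qprod: "?Q (prod f A)" if "\<And>i. i \<in> A \<Longrightarrow> ?Q (f i)" for f and A :: "(nat \<times> nat) set"
    using that
    by (induction A rule: infinite_finite_induct) (use Q1 Qmult in \<open>simp_all\<close>)
  have "?Q (Poly_Mapping.single m (Poly_Mapping.lookup p m))" if "m \<in> Poly_Mapping.keys p" for m
  proof -
    have sub: "Poly_Mapping.keys m \<subseteq> UNIV \<times> {1..r}"
      using p that by (simp add: diff_poly_ring_def)
    have "?Q (case v of (i, j) \<Rightarrow> dvar i j ^ Poly_Mapping.lookup m (i, j))"
      if "v \<in> Poly_Mapping.keys m" for v
    proof -
      obtain i j where [simp]: "v = (i, j)" by (cases v)
      have "j \<in> {1..r}" using sub that by auto
      then have "?Q (dvar i j)"
        using var diff_poly_ring_closed(4) by blast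
      then show ?thesis using Qpow by simp
    qed
    then have "?Q (\<Prod>v\<in>Poly_Mapping.keys m.
        case v of (i, j) \<Rightarrow> dvar i j ^ Poly_Mapping.lookup m (i, j))"
      by (rule Qprod)
    then show ?thesis
      unfolding single_eq_prod_dvar using Qmult const diff_poly_ring_closed(3) by blast
  qed
  then have "?Q (\<Sum>m\<in>Poly_Mapping.keys p. Poly_Mapping.single m (Poly_Mapping.lookup p m))"
    by (rule Qsum)
  then show ?thesis
    by (simp flip: mpoly_eq_sum_single)
qed

lemma dshift_closed:
  assumes "p \<in> carrier (diff_poly_ring r)"
  shows "dshift p \<in> carrier (diff_poly_ring r)"
  using assms
  by (induction rule: diff_poly_induct)
     (simp_all add: diff_poly_ring_closed diff_poly_ring_closed_mult)

lemma diff_eval_dshift: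
  assumes "p \<in> carrier (diff_poly_ring r)"
  shows "diff_eval x (dshift p) = seq_shift (diff_eval x p)"
  using assms by (induction rule: diff_poly_induct) (simp_all add: seq_shift_def fun_eq_iff)

text \<open>
  \<open>diff_eval x\<close> is the only algebra morphism that commutes with the shifts and maps
  \<open>T\<^sub>j\<close> to \<open>x\<^sub>j\<close>.
\<close>

lemma diff_eval_unique:
  assumes "\<phi> \<in> ring_hom (diff_poly_ring r) ring_of_type_algebra"
    and "\<And>c. \<phi> (dconst c) = (\<lambda>_. c)"
    and "\<And>p. p \<in> carrier (diff_poly_ring r) \<Longrightarrow> \<phi> (dshift p) = seq_shift (\<phi> p)"
    and "\<And>j. j \<in> {1..r} \<Longrightarrow> \<phi> (dvar 0 j) = x j"
    and "p \<in> carrier (diff_poly_ring r)"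
  shows "\<phi> p = diff_eval x p"
proof -
  have var: "\<phi> (dvar i j) = (seq_shift ^^ i) (x j)" if "j \<in> {1..r}" for i j
  proof (induction i)
    case (Suc i)
    then show ?case
      using assms(3)[OF diff_poly_ring_closed(4)[OF that], of i] by simp
  qed (use assms(4) that in simp)
  show ?thesis
    using assms(5)
  proof (induction rule: diff_poly_induct)
    case (add p q)
    then show ?case using ring_hom_add[OF assms(1), of p q]
      by (simp add: ring_of_type_algebra_def)
  next
    case (mult p q)
    then show ?case using ring_hom_mult[OF assms(1), of p q]
      by (simp add: ring_of_type_algebra_def)
  qed (simp_all add: assms(2) var)
qed

end

theory Submission
  imports Defs
begin

text \<open>
  Read the ternary digits of \<open>m\<close> as a program: starting from 0, the digits 0, 1, 2 stand for
  \<open>q \<mapsto> t q\<close>, \<open>q \<mapsto> q + 1\<close>, \<open>q \<mapsto> 2 - t q\<close>.  The program computes a polynomial \<open>W\<^sub>m(t)\<close> (\<open>code_value t m\<close>),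
  which is not the zero polynomial if \<open>m > 0\<close>.  Every nonzero integer polynomial is, up to a
  factor \<open>\<plusminus>2\<close>, some \<open>W\<^sub>m\<close>, so \<open>t\<close> avoids the roots of all of them iff it is transcendental.  A
  finite system of difference equations can run through all \<open>W\<^sub>m(t)\<close>, \<open>t\<close> constant, and force
  each of them to be invertible.  In round \<open>N\<close> of the run, a countdown of length \<open>N\<close> reads
  digits \<open>d\<close>, which are not determined by the equations, and accumulates the code \<open>A\<close> and the
  value \<open>q = W\<^sub>A(t)\<close>; at the end of the round \<open>A = N\<close> is imposed, whatever the digits were.

  The initial values of the run cannot be imposed directly.  Instead, another unknown
  \<open>e\<close> is multiplied with the initial conditions: a run starts wherever \<open>e\<close> is nonzero.  Hence
  \<open>e\<close> vanishes on all solutions over the algebraic numbers, but not on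
  a solution over the field of rational functions in \<open>t\<close>, so no power of \<open>e\<close> lies in the
  difference ideal.
\<close>

section \<open>Programs for integer polynomials\<close>

text \<open>Quadratic interpolation in \<open>d\<close>, so that a single polynomial equation covers
  all three operations.\<close>

definition code_step :: "'a::comm_ring_1 \<Rightarrow> 'a \<Rightarrow> 'a \<Rightarrow> 'a" where
  "code_step t d q = (1 - d) * t * q + d + d * (2 - d) * q"

fun code_value :: "'a::comm_ring_1 \<Rightarrow> nat \<Rightarrow> 'a" where
  "code_value t m =
     (if m = 0 then 0 else code_step t (of_nat (m mod 3)) (code_value t (m div 3)))"

declare code_value.simps [simp del]

lemma code_step_simps [simp]:
  "code_step t 0 q = t * q" "code_step t 1 q = q + 1" "code_step t 2 q = 2 - t * q"
  by (simp_all add: code_step_def algebra_simps)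

lemma code_value_0 [simp]: "code_value t 0 = 0"
  by (simp add: code_value.simps)

text \<open>The least significant digit is applied last, so appending a digit applies one more
  operation. Leading zeros do no harm since \<open>t * 0 = 0\<close>, which settles
  \<open>3 * m + d = 0\<close>.\<close>

lemma code_value_digit:
  assumes "d < 3"
  shows "code_value t (3 * m + d) = code_step t (of_nat d) (code_value t m)"
  using assms by (cases "3 * m + d = 0") (simp_all add: code_value.simps[of t "3 * m + d"])

lemma code_value_div:
  "code_value t m = code_step t (of_nat (m mod 3)) (code_value t (m div 3))"
  using code_value_digit[of "m mod 3" t "m div 3"] by simp

lemma code_value_digits:
  "code_value t (3 * m) = t * code_value t m"
  "code_value t (3 * m + 1) = code_value t m + 1"
  "code_value t (3 * m + 2) = 2 - t * code_value t m"
  using code_value_digit[of 0 t m] code_value_digit[of 1 t m] code_value_digit[of 2 t m]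
  by (simp_all del: One_nat_def)

lemma code_value_hom:
  fixes h :: "'a::comm_ring_1 \<Rightarrow> 'b::comm_ring_1"
  assumes [simp]: "h 0 = 0" "h 1 = 1" "\<And>x y. h (x + y) = h x + h y"
    "\<And>x y. h (x - y) = h x - h y" "\<And>x y. h (x * y) = h x * h y"
  shows "h (code_value t m) = code_value (h t) m"
proof (induction m rule: less_induct)
  case (less m)
  have [simp]: "h (of_nat n) = of_nat n" for n
    by (induction n) simp_all
  have [simp]: "h 2 = 2"
    using assms(3)[of 1 1] by simp
  show ?case
    using less[of "m div 3"]
    by (cases "m = 0") (simp_all add: code_value_div[of _ m] code_step_def)
qed

text \<open>Each appended digit 1 adds 1; the bound \<open>m' \<ge> m\<close> keeps codes
  positive.\<close>

lemma code_value_add_nat: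
  "\<exists>m'\<ge>m. code_value t m' = code_value t m + of_nat c"
proof (induction c)
  case (Suc c)
  then obtain m' where "m' \<ge> m" "code_value t m' = code_value t m + of_nat c"
    by blast
  then show ?case
    using code_value_digits(2)[of t m'] by (intro exI[of _ "3 * m' + 1"]) simp
qed auto

lemma code_value_pCons_nonzero:
  fixes m :: nat
  assumes "m > 0"
  shows "code_value [:0, 1:: 'a::{idom,ring_char_0}:] m \<noteq> 0"
proof -
  \<comment> \<open>Strengthened for the induction: \<open>q + 1\<close> would vanish at the
    constant -1, so constants have to be positive.\<close>
  have "(\<exists>c>0. code_value [:0, 1:: 'a:] m = [:of_nat c:]) \<or> degree (code_value [:0, 1:: 'a:] m) > 0"
    using assms
  proof (induction m rule: less_induct)
    case (less m)
    let ?W = "\<lambda>m. code_value [:0, 1:: 'a:] m"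
    consider "m = 1" | "m = 2" | "m div 3 > 0"
      using less.prems by linarith
    then show ?case
    proof cases
      assume "m = 1"
      then have "?W m = [:of_nat 1:]"
        using code_value_digits(2)[of "[:0, 1:: 'a:]" 0] by simp
      then show ?thesis by blast
    next
      assume "m = 2"
      then have "?W m = [:of_nat 2:]"
        using code_value_digits(3)[of "[:0, 1:: 'a:]" 0] \<open>m = 2\<close> by (simp add: numeral_poly numeral_2_eq_2)
      then show ?thesis using zero_less_numeral by blast
    next
      assume "m div 3 > 0"
      then have IH: "(\<exists>c>0. ?W (m div 3) = [:of_nat c:]) \<or> degree (?W (m div 3)) > 0"
        using less.IH[of "m div 3"] less.prems by simp
      then have nz: "?W (m div 3) \<noteq> 0"
        by auto
      have "m mod 3 = 0 \<or> m mod 3 = 1 \<or> m mod 3 = 2"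
        by linarith
      then consider "?W m = [:0, 1:] * ?W (m div 3)" | "?W m = ?W (m div 3) + 1"
        | "?W m = 2 - [:0, 1:] * ?W (m div 3)"
        using code_value_div[of "[:0, 1:: 'a:]" m] by auto
      then show ?thesis
      proof cases
        case 1
        then show ?thesis using nz by simp
      next
        case 2
        from IH show ?thesis
        proof (elim disjE exE conjE)
          fix c :: nat
          assume "?W (m div 3) = [:of_nat c:]"
          then have "?W m = [:of_nat (Suc c):]"
            using 2 by (simp add: one_pCons)
          then show ?thesis by blast
        next
          assume "degree (?W (m div 3)) > 0"
          then show ?thesis
            using 2 degree_add_eq_left[of 1 "?W (m div 3)"] by simp
        qed
      next
        case 3
        have "degree (?W m) = degree (- ([:0, 1:] * ?W (m div 3)) + 2)"
          using 3 by (simp only: diff_conv_add_uminus add.commute)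
        also have "\<dots> = degree (- ([:0, 1:] * ?W (m div 3)))"
          using nz by (intro degree_add_eq_left) (simp add: numeral_poly)
        finally show ?thesis using nz by simp
      qed
    qed
  qed
  then show ?thesis by auto
qed

text \<open>
  Horner's scheme.  The sign of the value can be changed only together with a multiplication
  by \<open>t\<close>, which adds 2; this is why the polynomials are doubled and only determined up to sign.
\<close>

lemma code_value_of_int_poly:
  fixes a :: "'a::{idom,ring_char_0}"
  assumes "\<And>i. Polynomial.coeff p i \<in> \<int>" "p \<noteq> 0"
  shows "\<exists>m>0. code_value a m = 2 * poly p a \<or> code_value a m = - (2 * poly p a)"
  using assms
proof (induction p)
  case (pCons c p)
  obtain z where z: "c = of_int z"
    using pCons.prems(1)[of 0] Ints_cases by auto
  have coeffs: "Polynomial.coeff p i \<in> \<int>" for i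
    using pCons.prems(1)[of "Suc i"] by simp
  show ?case
  proof (cases "p = 0")
    case True
    with pCons.prems(2) z have "z \<noteq> 0" by auto
    obtain m where m: "code_value a m = of_nat (2 * nat \<bar>z\<bar>)"
      using code_value_add_nat[of 0 a "2 * nat \<bar>z\<bar>"] by auto
    then have val: "code_value a m = 2 * of_int \<bar>z\<bar>"
      by simp
    have "m \<noteq> 0"
      using val \<open>z \<noteq> 0\<close> by (intro notI) simp
    then show ?thesis
      using val True z by (intro exI[of _ m]) (auto simp: abs_if)
  next
    case False
    then obtain m s where m: "m > 0" "code_value a m = of_int s * (2 * poly p a)" "s = 1 \<or> s = -1"
    proof -
      from pCons.IH[OF coeffs False] obtain m where
        "m > 0" "code_value a m = 2 * poly p a \<or> code_value a m = - (2 * poly p a)"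
        by blast
      then show ?thesis
        using that[of m 1] that[of m "-1"] by auto
    qed
    show ?thesis
    proof (cases "s * z \<ge> 0")
      case True
      obtain m' where m': "m' \<ge> 3 * m"
          "code_value a m' = code_value a (3 * m) + of_nat (2 * nat (s * z))"
        using code_value_add_nat[of "3 * m"] by blast
      then have "code_value a m' = a * (of_int s * (2 * poly p a)) + 2 * of_int (s * z)"
        using m True by (simp add: code_value_digits)
      then show ?thesis
        using m(1,3) m'(1) z by (intro exI[of _ m']) (auto simp: algebra_simps)
    next
      \<comment> \<open>The constant has the wrong sign: digit 2 negates and already contributes 2,
        hence the \<open>- 1\<close> in the number of increments.\<close>
      case False
      obtain m' where m': "m' \<ge> 3 * m + 2"
          "code_value a m' = code_value a (3 * m + 2) + of_nat (2 * nat (- (s * z) - 1))"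
        using code_value_add_nat[of "3 * m + 2"] by blast
      then have "code_value a m' =
          2 - a * (of_int s * (2 * poly p a)) + 2 * of_int (- (s * z) - 1)"
        using m False unfolding m'(2) code_value_digits(3) by simp
      then show ?thesis
        using m'(1) m(3) z by (intro exI[of _ m']) (auto simp: algebra_simps)
    qed
  qed
qed simp

section \<open>Algebraic numbers as roots of programs\<close>

lemma algebraic_imp_code_value_0:
  assumes "algebraic a"
  shows "\<exists>m>0. code_value a m = 0"
proof -
  obtain p where "\<And>i. Polynomial.coeff p i \<in> \<int>" "p \<noteq> 0" "poly p a = 0"
    using assms by (auto simp: algebraic_def)
  then show ?thesis
    using code_value_of_int_poly[of p a] by auto
qed

lemma algebraic_rat_alg_closure:
  fixes a :: "rat alg_closure"
  shows "algebraic a"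
proof -
  obtain p where p: "poly (map_poly to_ac p) a = 0" "p \<noteq> 0"
    using alg_closure_algebraic[of a] by blast
  \<comment> \<open>\<open>algebraic\<close> asks for integer coefficients, but
    \<open>algebraicI'\<close> accepts rational ones.\<close>
  have rat: "(to_ac x :: rat alg_closure) \<in> \<rat>" for x
    by (cases x) (metis Fract_of_int_quotient Rats_divide Rats_of_int to_ac_divide to_ac_of_int)
  show ?thesis
  proof (rule algebraicI')
    show "map_poly to_ac p \<noteq> 0"
      using p(2) by (simp add: map_poly_eq_0_iff)
  qed (use p rat in \<open>simp_all add: coeff_map_poly\<close>)
qed

section \<open>Evaluation at sequences over an extension\<close>

locale comm_ring_hom =
  fixes h :: "'k::comm_ring_1 \<Rightarrow> 'b::comm_ring_1"
  assumes zero: "h 0 = 0" and one: "h 1 = 1"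
    and add: "h (c + d) = h c + h d" and mult: "h (c * d) = h c * h d"
begin

text \<open>For \<open>h\<close> the identity this is \<open>diff_eval\<close>; an embedding
  \<open>h\<close> allows solutions with values in an extension field.\<close>

definition seq_eval :: "(nat \<Rightarrow> nat \<Rightarrow> 'b) \<Rightarrow> 'k diff_poly \<Rightarrow> nat \<Rightarrow> 'b" where
  "seq_eval x = mpoly_eval (\<lambda>c _. h c) (\<lambda>(i, j). (seq_shift ^^ i) (x j))"

lemma seq_eval_hom [simp]:
  "seq_eval x 0 = 0" "seq_eval x 1 = 1"
  "seq_eval x (p + q) = seq_eval x p + seq_eval x q"
  "seq_eval x (p * q) = seq_eval x p * seq_eval x q"
  using mpoly_eval_power[of "\<lambda>c _. h c" _ _ 0]
  by (simp_all add: seq_eval_def mpoly_eval_add mpoly_eval_mult fun_eq_iff zero one add mult)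

lemma seq_eval_minus [simp]: "seq_eval x (p - q) = seq_eval x p - seq_eval x q"
  using seq_eval_hom(3)[of x "p - q" q] by (simp add: eq_diff_eq)

lemma seq_eval_power [simp]: "seq_eval x (p ^ n) = seq_eval x p ^ n"
  by (induction n) simp_all

lemma seq_eval_numeral [simp]: "seq_eval x (numeral n) = numeral n"
proof -
  have "seq_eval x (of_nat m) = of_nat m" for m
    by (induction m) simp_all
  from this[of "numeral n"] show ?thesis by simp
qed

lemma seq_eval_dconst: "seq_eval x (dconst c) = (\<lambda>_. h c)"
  by (simp add: seq_eval_def dconst_def mpoly_eval_single fun_eq_iff zero)

lemma seq_eval_dvar [simp]: "seq_eval x (dvar i j) = (seq_shift ^^ i) (x j)"
  by (simp add: seq_eval_def dvar_def mpoly_eval_single fun_eq_iff zero one)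

lemma seq_eval_dshift:
  assumes "p \<in> carrier (diff_poly_ring r)"
  shows "seq_eval x (dshift p) = seq_shift (seq_eval x p)"
  using assms
  by (induction rule: diff_poly_induct) (simp_all add: seq_shift_def fun_eq_iff seq_eval_dconst)

lemma ideal_seq_eval_kernel:
  "ideal {p \<in> carrier (diff_poly_ring r). seq_eval x p = 0} (diff_poly_ring r)"
    (is "ideal ?I ?R")
proof -
  interpret R: cring ?R by (rule diff_poly_ring_cring)
  show ?thesis
  proof (rule idealI)
    show "subgroup ?I (add_monoid ?R)"
    proof (rule R.add.subgroupI)
      fix p assume p: "p \<in> ?I"
      have "\<ominus>\<^bsub>?R\<^esub> p = - p"
        using p diff_poly_ring_closed(5)[of p r] by (intro R.minus_equality) auto
      moreover have "seq_eval x (- p) = 0"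
        using p seq_eval_minus[of x 0 p] by simp
      ultimately show "\<ominus>\<^bsub>?R\<^esub> p \<in> ?I"
        using p diff_poly_ring_closed(5)[of p r] by simp
    qed (use diff_poly_ring_closed(1)[of r] in \<open>auto simp: diff_poly_ring_closed(6)\<close>)
  qed (auto simp: diff_poly_ring_closed_mult R.ring_axioms)
qed

text \<open>The kernel of evaluation is an ideal, and it contains all shifts of \<open>F\<close>
  because evaluation commutes with the shift.\<close>

lemma seq_eval_radical:
  assumes F: "F \<subseteq> carrier (diff_poly_ring r)" "\<And>f. f \<in> F \<Longrightarrow> seq_eval x f = 0"
    and p: "p \<in> ideal_radical (diff_poly_ring r)
              (Idl\<^bsub>diff_poly_ring r\<^esub> (\<Union>i::nat. (dshift ^^ i) ` F))"
  shows "\<exists>n. seq_eval x p ^ n = 0"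
proof -
  interpret R: cring "diff_poly_ring r" by (rule diff_poly_ring_cring)
  let ?I = "{p \<in> carrier (diff_poly_ring r). seq_eval x p = 0}"
  have "(dshift ^^ i) f \<in> ?I" if "f \<in> F" for i f
  proof (induction i)
    case (Suc i)
    then show ?case
      by (auto simp: dshift_closed seq_eval_dshift seq_shift_def fun_eq_iff)
  qed (use F that in auto)
  then have "Idl\<^bsub>diff_poly_ring r\<^esub> (\<Union>i. (dshift ^^ i) ` F) \<subseteq> ?I"
    by (intro R.genideal_minimal ideal_seq_eval_kernel) auto
  then obtain n :: nat where "p [^]\<^bsub>diff_poly_ring r\<^esub> n \<in> ?I"
    using p by (auto simp: ideal_radical_def)
  then show ?thesis
    by (auto simp: diff_poly_ring_pow)
qed

end

interpretation diff_eval: comm_ring_hom "\<lambda>c. c"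
  rewrites "comm_ring_hom.seq_eval (\<lambda>c. c) = diff_eval"
proof -
  show *: "comm_ring_hom (\<lambda>c::'a::comm_ring_1. c)"
    by standard simp_all
  show "comm_ring_hom.seq_eval (\<lambda>c::'a. c) = diff_eval"
    by (simp add: fun_eq_iff comm_ring_hom.seq_eval_def[OF *] diff_eval_def)
qed

text \<open>Over a domain the ring of sequences has no nonzero nilpotents, as powers are taken
  componentwise.\<close>

lemma radical_subset_vanishing:
  fixes F :: "'k::idom diff_poly set"
  assumes "F \<subseteq> carrier (diff_poly_ring r)"
  shows "ideal_radical (diff_poly_ring r) (Idl\<^bsub>diff_poly_ring r\<^esub> (\<Union>i::nat. (dshift ^^ i) ` F))
    \<subseteq> diff_vanishing r (diff_solutions r F)"
proof
  fix p
  assume p: "p \<in> ideal_radical (diff_poly_ring r)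
    (Idl\<^bsub>diff_poly_ring r\<^esub> (\<Union>i::nat. (dshift ^^ i) ` F))"
  have "diff_eval x p = 0" if "x \<in> diff_solutions r F" for x
  proof -
    have "diff_eval x f = 0" if "f \<in> F" for f
      using that \<open>x \<in> diff_solutions r F\<close> by (simp add: diff_solutions_def)
    then obtain n where "diff_eval x p ^ n = 0"
      using diff_eval.seq_eval_radical[OF assms _ p, of x] by blast
    moreover have "(g ^ n) i = g i ^ n" for g :: "nat \<Rightarrow> 'k" and i
      by (induction n) simp_all
    ultimately have "diff_eval x p i ^ n = 0" for i
      by (metis zero_fun_apply)
    then show ?thesis
      by (auto simp: fun_eq_iff)
  qed
  then show "p \<in> diff_vanishing r (diff_solutions r F)"
    using p by (simp add: diff_vanishing_def ideal_radical_def)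
qed


section \<open>The difference system\<close>

text \<open>
  The number \<open>b = 1 - k w\<close> is 1 if \<open>k = 0\<close>, at the end of a round, and 0 otherwise. In the first
  case \<open>w\<close> is the inverse of \<open>q\<close>, in the second the inverse of \<open>k\<close>.
\<close>

locale run =
  fixes t N k A q d w e :: "nat \<Rightarrow> 'a::comm_ring_1"
  assumes t: "t (Suc n) = t n"
    and k_b: "k n * (1 - k n * w n) = 0"
    and q_inverse: "(1 - k n * w n) * (q n * w n - 1) = 0"
    and A_final: "(1 - k n * w n) * (A n - N n) = 0"
    and digit: "d n * (d n - 1) * (d n - 2) = 0"
    and N_Suc: "N (Suc n) = N n + (1 - k n * w n)"
    and k_Suc: "k (Suc n) = k n - 1 + (1 - k n * w n) * (N n + 2)"
    and A_Suc: "A (Suc n) = k n * w n * (3 * A n + d n)"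
    and q_Suc: "q (Suc n) = k n * w n * code_step (t n) (d n) (q n)"
    and start: "e n * (N n - 1) = 0" "e n * (k n - 1) = 0" "e n * A n = 0" "e n * q n = 0"

definition run_system :: "'k::comm_ring_1 diff_poly set" where
  "run_system =
     (let t = dvar 0 1; N = dvar 0 2; k = dvar 0 3; A = dvar 0 4; q = dvar 0 5;
          d = dvar 0 6; w = dvar 0 7; e = dvar 0 8
      in {dvar 1 1 - t, k * (1 - k * w), (1 - k * w) * (q * w - 1), (1 - k * w) * (A - N),
          d * (d - 1) * (d - 2), dvar 1 2 - (N + (1 - k * w)),
          dvar 1 3 - (k - 1 + (1 - k * w) * (N + 2)),
          dvar 1 4 - k * w * (3 * A + d), dvar 1 5 - k * w * code_step t d q,
          e * (N - 1), e * (k - 1), e * A, e * q})"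

lemma run_system_closed: "run_system \<subseteq> carrier (diff_poly_ring 8)"
proof -
  let ?R = "diff_poly_ring 8"
  have minus: "p - p' \<in> carrier ?R" if "p \<in> carrier ?R" "p' \<in> carrier ?R"
    for p p' :: "'a diff_poly"
    using diff_poly_ring_closed(6)[of p 8 "- p'"] diff_poly_ring_closed(5)[of p' 8] that by simp
  have "(of_nat n :: 'a diff_poly) \<in> carrier ?R" for n
    by (induction n) (simp_all add: diff_poly_ring_closed)
  from this[of "numeral _"] have numeral: "(numeral n :: 'a diff_poly) \<in> carrier ?R" for n
    by simp
  show ?thesis
    by (auto simp: run_system_def Let_def code_step_def
        intro!: minus numeral diff_poly_ring_closed diff_poly_ring_closed_mult)
qed

lemma finite_run_system: "finite run_system"
  by (simp add: run_system_def Let_def)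

lemma (in comm_ring_hom) seq_eval_run_system:
  "(\<forall>f\<in>run_system. seq_eval x f = 0) \<longleftrightarrow> run (x 1) (x 2) (x 3) (x 4) (x 5) (x 6) (x 7) (x 8)"
proof -
  have "(of_nat n :: nat \<Rightarrow> 'b) i = of_nat n" for n i
    by (induction n) simp_all
  from this[of "numeral _"] have [simp]: "(numeral n :: nat \<Rightarrow> 'b) i = numeral n" for n i
    by simp
  have [simp]: "(seq_shift ^^ 1) y n = y (Suc n)" for y :: "nat \<Rightarrow> 'b" and n
    by (simp add: seq_shift_def)
  show ?thesis
    by (simp add: run_system_def Let_def run_def code_step_def fun_eq_iff
        all_conj_distrib del: One_nat_def)
qed

section \<open>Runs over a field of characteristic 0\<close>

context run
begin

lemma t_const: "t n = t 0"
  by (induction n) (simp_all add: t)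

end

locale field_run = run t N k A q d w e
  for t N k A q d w e :: "nat \<Rightarrow> 'a::field_char_0"
begin

text \<open>In a field, \<open>k_b\<close> makes \<open>w n\<close> the inverse of
  \<open>k n\<close>, so \<open>b = 0\<close>.\<close>

lemma counting:
  assumes "k n \<noteq> 0"
  shows "N (Suc n) = N n" "k (Suc n) = k n - 1" "A (Suc n) = 3 * A n + d n"
    "q (Suc n) = code_step (t n) (d n) (q n)"
proof -
  have "k n * w n = 1"
    using k_b[of n] assms by simp
  then show "N (Suc n) = N n" "k (Suc n) = k n - 1" "A (Suc n) = 3 * A n + d n"
    "q (Suc n) = code_step (t n) (d n) (q n)"
    using N_Suc k_Suc A_Suc q_Suc by simp_all
qed

text \<open>Each step appends a digit to the code \<open>A\<close> and applies it to
  \<open>q\<close>, so \<open>q\<close> stays the value of \<open>A\<close> whichever digits are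
  read.\<close>

lemma round:
  assumes "N n = of_nat M" "k n = of_nat K" "A n = of_nat a" "q n = code_value (t 0) a"
  shows "\<exists>a. N (n + K) = of_nat M \<and> k (n + K) = 0 \<and> A (n + K) = of_nat a \<and>
    q (n + K) = code_value (t 0) a"
  using assms
proof (induction K arbitrary: n a)
  case (Suc K)
  \<comment> \<open>By characteristic 0 the countdown cannot reach zero early.\<close>
  have "k n \<noteq> 0"
    using Suc.prems(2) of_nat_neq_0[of K] by metis
  note step = counting[OF this]
  have "d n = of_nat 0 \<or> d n = of_nat 1 \<or> d n = of_nat 2"
    using digit[of n] by auto
  then obtain c :: nat where c: "d n = of_nat c" "c < 3"
    using that[of 0] that[of 1] that[of 2] by auto
  have "\<exists>a. N (Suc n + K) = of_nat M \<and> k (Suc n + K) = 0 \<and> A (Suc n + K) = of_nat a \<and>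
      q (Suc n + K) = code_value (t 0) a"
  proof (rule Suc.IH)
    show "A (Suc n) = of_nat (3 * a + c)"
      using step(3) Suc.prems(3) c by simp
    show "q (Suc n) = code_value (t 0) (3 * a + c)"
      using step(4) Suc.prems(4) c t_const[of n] by (simp add: code_value_digit)
  qed (use step Suc.prems in simp_all)
  then show ?case by simp
qed auto

text \<open>Here \<open>b = 1\<close>. The update of \<open>k\<close> is
  \<open>0 - 1 + (N n + 2)\<close>, so the next round starts with \<open>N\<close> and
  \<open>k\<close> both equal to \<open>N n + 1\<close>.\<close>

lemma round_end:
  assumes "k n = 0"
  shows "A n = N n" "q n \<noteq> 0" "N (Suc n) = N n + 1" "k (Suc n) = N n + 1"
    "A (Suc n) = 0" "q (Suc n) = 0"
  using assms A_final[of n] q_inverse[of n] N_Suc[of n] k_Suc[of n] A_Suc[of n] q_Suc[of n]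
  by auto

lemma round_value_nonzero:
  assumes "N n = of_nat M" "k n = of_nat M" "A n = 0" "q n = 0"
  shows "k (n + M) = 0" "N (n + M) = of_nat M" "code_value (t 0) M \<noteq> 0"
proof -
  obtain a where a: "N (n + M) = of_nat M" "k (n + M) = 0" "A (n + M) = of_nat a"
      "q (n + M) = code_value (t 0) a"
    using round[of n M M 0] assms by auto
  \<comment> \<open>\<open>A_final\<close> together with characteristic 0 identifies the code,
    although the digits were free.\<close>
  moreover from a have "a = M"
    using round_end(1)[of "n + M"] by simp
  ultimately show "k (n + M) = 0" "N (n + M) = of_nat M" "code_value (t 0) M \<noteq> 0"
    using round_end(2)[of "n + M"] by auto
qed

lemma code_value_nonzero:
  assumes "e n \<noteq> 0" "m > 0"
  shows "code_value (t 0) m \<noteq> 0"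
proof -
  have "\<exists>n. N n = of_nat m \<and> k n = of_nat m \<and> A n = 0 \<and> q n = 0"
    using assms(2)
  proof (induction m rule: nat_induct_non_zero)
    case 1
    then show ?case
      using start[of n] assms(1) by (intro exI[of _ n]) simp
  next
    case (Suc m)
    then obtain n where "N n = of_nat m" "k n = of_nat m" "A n = 0" "q n = 0"
      by blast
    note * = round_value_nonzero[OF this]
    show ?case
      \<comment> \<open>Round \<open>m\<close> ends at \<open>n + m\<close>; the reset takes one
        more step.\<close>
      using round_end[OF *(1)] *(2) by (intro exI[of _ "Suc (n + m)"]) simp
  qed
  then show ?thesis
    using round_value_nonzero(3) by blast
qed

end

text \<open>The constant value of \<open>t\<close> is algebraic, hence a root of some program with
  positive code, which a nonzero \<open>e n\<close> would forbid.\<close>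

lemma dvar_vanishing:
  "dvar 0 8 \<in> diff_vanishing 8 (diff_solutions 8 (run_system :: rat alg_closure diff_poly set))"
proof -
  have "x 8 = 0" if "x \<in> diff_solutions 8 run_system" for x :: "nat \<Rightarrow> nat \<Rightarrow> rat alg_closure"
  proof
    fix n
    interpret field_run "x 1" "x 2" "x 3" "x 4" "x 5" "x 6" "x 7" "x 8"
      using that diff_eval.seq_eval_run_system[of x]
      by (simp add: diff_solutions_def field_run_def)
    obtain m where "m > 0" "code_value (x 1 0) m = 0"
      using algebraic_imp_code_value_0[OF algebraic_rat_alg_closure] by blast
    then show "x 8 n = 0 n"
      using code_value_nonzero[of n m] by auto
  qed
  then show ?thesis
    by (auto simp: diff_vanishing_def diff_poly_ring_closed)
qed

section \<open>A run at a transcendental\<close>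

text \<open>The pairs \<open>(N, k)\<close> of the run: round \<open>N\<close> counts
  \<open>k\<close> down from \<open>N\<close> to 0 and so lasts \<open>N + 1\<close> steps.\<close>

fun schedule :: "nat \<Rightarrow> nat \<times> nat" where
  "schedule 0 = (1, 1)"
| "schedule (Suc n) = (case schedule n of (N, k) \<Rightarrow> if k = 0 then (N + 1, N + 1) else (N, k - 1))"

lemma schedule_pos: "fst (schedule n) > 0"
  by (induction n) (auto split: prod.splits)

text \<open>
  While \<open>k\<close> digits are still to be read in round \<open>N\<close>, the code is \<open>N div 3 ^ k\<close>.
\<close>

lemma run_schedule:
  fixes \<tau> :: "'a::field"
  assumes char: "\<And>m. m > 0 \<Longrightarrow> (of_nat m :: 'a) \<noteq> 0"
    and nz: "\<And>m. m > 0 \<Longrightarrow> code_value \<tau> m \<noteq> 0"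
  defines "N \<equiv> \<lambda>n. fst (schedule n)" and "k \<equiv> \<lambda>n. snd (schedule n)"
  shows "run (\<lambda>_. \<tau>) (\<lambda>n. of_nat (N n)) (\<lambda>n. of_nat (k n)) (\<lambda>n. of_nat (N n div 3 ^ k n))
    (\<lambda>n. code_value \<tau> (N n div 3 ^ k n)) (\<lambda>n. of_nat (N n div 3 ^ (k n - 1) mod 3))
    (\<lambda>n. if k n = 0 then inverse (code_value \<tau> (N n)) else inverse (of_nat (k n)))
    (\<lambda>n. if n = 0 then 1 else 0)"
proof -
  have Suc: "N (Suc n) = (if k n = 0 then N n + 1 else N n)"
    "k (Suc n) = (if k n = 0 then N n + 1 else k n - 1)" for n
    by (simp_all add: N_def k_def split: prod.splits)
  have init: "N 0 = 1" "k 0 = 1"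
    by (simp_all add: N_def k_def)
  \<comment> \<open>\<open>N\<close> ternary digits suffice to write \<open>N\<close>, so the code
    is 0 at the start of round \<open>N\<close>.\<close>
  have "n < 3 ^ n" for n :: nat
    by (induction n) auto
  then have small [simp]: "m div 3 ^ m = 0" for m :: nat
    by simp
  have nz': "code_value \<tau> (N n) \<noteq> 0" for n
    using nz schedule_pos[of n] by (simp add: N_def)
  have div: "N n div 3 ^ k n = N n div 3 ^ (k n - 1) div 3" if "k n \<noteq> 0" for n
    using that by (cases "k n") (simp_all add: div_mult2_eq power_Suc2 del: power_Suc)
  \<comment> \<open>Truncated subtraction makes the digit \<open>N n mod 3\<close> when
    \<open>k n = 0\<close>, so the digit equation holds at the end of a round as well.\<close>
  have digit: "(of_nat c :: 'a) * (of_nat c - 1) * (of_nat c - 2) = 0" if "c < 3" for c :: nat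
  proof -
    have "c = 0 \<or> c = 1 \<or> c = 2" using that by linarith
    then show ?thesis by auto
  qed
  have A: "of_nat (N n div 3 ^ (k n - 1)) =
      3 * of_nat (N n div 3 ^ k n) + (of_nat (N n div 3 ^ (k n - 1) mod 3) :: 'a)" if "k n \<noteq> 0" for n
    unfolding div[OF that] by (metis of_nat_add of_nat_mult of_nat_numeral mult_div_mod_eq)
  have q: "code_value \<tau> (N n div 3 ^ (k n - 1)) =
      code_step \<tau> (of_nat (N n div 3 ^ (k n - 1) mod 3)) (code_value \<tau> (N n div 3 ^ k n))"
    if "k n \<noteq> 0" for n
    unfolding div[OF that] by (rule code_value_div)
  have small_Suc [simp]: "Suc m div (3 * 3 ^ m) = 0" for m :: nat
    using small[of "Suc m"] by simp
  show ?thesis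
  proof
    fix n
    show "of_nat (N (Suc n) div 3 ^ k (Suc n)) = of_nat (k n) *
        (if k n = 0 then inverse (code_value \<tau> (N n)) else inverse (of_nat (k n))) *
        (3 * of_nat (N n div 3 ^ k n) + (of_nat (N n div 3 ^ (k n - 1) mod 3) :: 'a))"
      using A[of n] char[of "k n"] by (cases "k n = 0") (simp_all add: Suc)
    show "code_value \<tau> (N (Suc n) div 3 ^ k (Suc n)) = of_nat (k n) *
        (if k n = 0 then inverse (code_value \<tau> (N n)) else inverse (of_nat (k n))) *
        code_step \<tau> (of_nat (N n div 3 ^ (k n - 1) mod 3)) (code_value \<tau> (N n div 3 ^ k n))"
      using q[of n] char[of "k n"] by (cases "k n = 0") (simp_all add: Suc)
    show "of_nat (k (Suc n)) = of_nat (k n) - 1 + (1 - of_nat (k n) *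
        (if k n = 0 then inverse (code_value \<tau> (N n)) else inverse (of_nat (k n)))) *
        (of_nat (N n) + (2 :: 'a))"
      using char[of "k n"] by (cases "k n = 0") (simp_all add: Suc of_nat_diff)
  qed (use nz' char in \<open>simp_all add: Suc init digit\<close>)
qed

lemma dvar_notin_radical:
  "dvar 0 8 \<notin> ideal_radical (diff_poly_ring 8)
     (Idl\<^bsub>diff_poly_ring 8\<^esub> (\<Union>i::nat. (dshift ^^ i) ` (run_system :: 'k::field_char_0 diff_poly set)))"
proof
  assume rad: "dvar 0 8 \<in> ideal_radical (diff_poly_ring 8)
     (Idl\<^bsub>diff_poly_ring 8\<^esub> (\<Union>i::nat. (dshift ^^ i) ` (run_system :: 'k diff_poly set)))"
  interpret comm_ring_hom "\<lambda>c::'k. to_fract [:c:]"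
  proof
    show "to_fract [:1::'k:] = 1"
      by (metis one_pCons to_fract_1)
    show "to_fract [:c + d:] = to_fract [:c:] + to_fract [:d:]" for c d :: 'k
      by (simp flip: to_fract_add)
    show "to_fract [:c * d:] = to_fract [:c:] * to_fract [:d:]" for c d :: 'k
      by (simp flip: to_fract_mult)
  qed simp_all
  \<comment> \<open>The indeterminate serves as the transcendental: its programs are nonzero
    polynomials and stay nonzero in the fraction field.\<close>
  have "to_fract (code_value [:0, 1::'k:] m) = code_value (to_fract [:0, 1:]) m" for m
    by (rule code_value_hom) simp_all
  then have "code_value (to_fract [:0, 1::'k:]) m \<noteq> 0" if "m > 0" for m
    using code_value_pCons_nonzero[OF that, where ?'a = 'k] to_fract_eq_0_iff by metis
  moreover have "(of_nat m :: 'k poly fract) \<noteq> 0" if "m > 0" for m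
  proof -
    have "to_fract (of_nat m :: 'k poly) = of_nat m"
      by (induction m) simp_all
    then show ?thesis
      using that by (metis of_nat_eq_0_iff to_fract_eq_0_iff less_irrefl)
  qed
  ultimately obtain t N k A q d w :: "nat \<Rightarrow> 'k poly fract" where
    run: "run t N k A q d w (\<lambda>n. if n = 0 then 1 else 0)"
    using run_schedule[of "to_fract [:0, 1::'k:]"] by blast
  \<comment> \<open>The unknowns are numbered from 1; the extra \<open>t\<close> in front fills
    index 0.\<close>
  define x where "x = (!) [t, t, N, k, A, q, d, w, \<lambda>n. if n = 0 then 1 else 0]"
  have "\<forall>f\<in>run_system. seq_eval x f = 0"
    using run by (simp add: seq_eval_run_system x_def)
  then obtain n where "seq_eval x (dvar 0 8) ^ n = 0"
    using seq_eval_radical[OF run_system_closed _ rad] by blast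
  moreover have "(g ^ n) 0 = g 0 ^ n" for g :: "nat \<Rightarrow> 'k poly fract"
    by (induction n) simp_all
  ultimately have "seq_eval x (dvar 0 8) 0 ^ n = 0"
    by (metis zero_fun_apply)
  then show False
    by (simp add: x_def)
qed

theorem theorem3p2:
  shows "\<exists>(r::nat) (F :: rat alg_closure diff_poly set).
    r \<ge> 1 \<and> finite F \<and> F \<subseteq> carrier (diff_poly_ring r) \<and>
    ideal_radical (diff_poly_ring r) (Idl\<^bsub>diff_poly_ring r\<^esub> (\<Union>i::nat. (dshift ^^ i) ` F))
      \<subset> diff_vanishing r (diff_solutions r F)"
proof (intro exI conjI)
  show "ideal_radical (diff_poly_ring 8) (Idl\<^bsub>diff_poly_ring 8\<^esub> (\<Union>i::nat. (dshift ^^ i) ` run_system))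
      \<subset> diff_vanishing 8 (diff_solutions 8 (run_system :: rat alg_closure diff_poly set))"
    \<comment> \<open>The unknown \<open>e\<close>, that is \<open>dvar 0 8\<close>, makes the
      inclusion strict.\<close>
    using radical_subset_vanishing[OF run_system_closed] dvar_vanishing dvar_notin_radical
    by blast
qed (simp_all add: run_system_closed finite_run_system)

end
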